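(* Let $(A,1_l)$ be a left-unital algebra. Then $$AC_l(A)=AC_l(A)\cdot 1_l\oplus Ann_A^l(A).$$ Moreover, $AC_l(A)\cdot 1_l=AC_l(A)$ if and only if $Ann_A^l(A)=\{0\}$.
   Context: An algebra $A$ over a field $\mathbb{F}$ is a linear space with a bilinear product $(x,y)\mapsto x\cdot y$ (not assumed associative or commutative). It is left-unital if equipped with $1_l\in A$ such that $1_l\cdot x=x$ for all $x\in A$. Define the linear subspaces $$AC_l(A)=\{a\in A\mid a\cdot(x\cdot z)=x\cdot(a\cdot z)\ \text{and}\ (a\cdot x)\cdot(y\cdot z)=a\cdot((x\cdot y)\cdot z)\ \ \forall x,y,z\in A\},$$ $$AC_l(A)\cdot 1_l=\{a\cdot 1_l\mid a\in AC_l(A)\},\qquad Ann_A^l(A)=\{a\in A\mid a\cdot x=0\ \forall x\in A\}.$$ The symbol $\oplus$ denotes internal direct sum of linear subspaces. *)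

theory Defs
  imports Complex_Main
begin

locale algebra_over_field = vector_space scale
  for scale :: "'f::field \<Rightarrow> 'a::ab_group_add \<Rightarrow> 'a" (infixr \<open>*s\<close> 75) +
  fixes mult :: "'a \<Rightarrow> 'a \<Rightarrow> 'a" (infixl \<open>\<cdot>\<close> 70)
  assumes linear_mult_right: "Vector_Spaces.linear scale scale (\<lambda>y. x \<cdot> y)"
    and linear_mult_left: "Vector_Spaces.linear scale scale (\<lambda>x. x \<cdot> y)"

locale left_unital_algebra = algebra_over_field scale mult
  for scale :: "'f::field \<Rightarrow> 'a::ab_group_add \<Rightarrow> 'a" (infixr \<open>*s\<close> 75)
    and mult :: "'a \<Rightarrow> 'a \<Rightarrow> 'a" (infixl \<open>\<cdot>\<close> 70) +
  fixes one_l :: 'a (\<open>1\<^sub>l\<close>)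
  assumes left_unit: "1\<^sub>l \<cdot> x = x"

definition AC_l :: "('a \<Rightarrow> 'a \<Rightarrow> 'a) \<Rightarrow> 'a set" where
  "AC_l m = {a. \<forall>x y z. m a (m x z) = m x (m a z) \<and> m (m a x) (m y z) = m a (m (m x y) z)}"

definition AC_l_one :: "('a \<Rightarrow> 'a \<Rightarrow> 'a) \<Rightarrow> 'a \<Rightarrow> 'a set" where
  "AC_l_one m e = {m a e | a. a \<in> AC_l m}"

definition Ann_l :: "('a \<Rightarrow> 'a \<Rightarrow> 'a::zero) \<Rightarrow> 'a set" where
  "Ann_l m = {a. \<forall>x. m a x = 0}"

definition internal_direct_sum ::
    "('f::field \<Rightarrow> 'a::ab_group_add \<Rightarrow> 'a) \<Rightarrow> 'a set \<Rightarrow> 'a set \<Rightarrow> 'a set \<Rightarrow> bool" where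
  "internal_direct_sum scale U V W \<longleftrightarrow>
     module.subspace scale U \<and> module.subspace scale V \<and> module.subspace scale W \<and>
     U = {v + w | v w. v \<in> V \<and> w \<in> W} \<and> V \<inter> W = {0}"

end

theory Submission
  imports Defs
begin

text \<open>
  Right multiplication by the left unit, \<open>a \<mapsto> a \<cdot> 1\<^sub>l\<close>, is a linear projection of
  \<open>AC_l\<close> onto \<open>AC_l \<cdot> 1\<^sub>l\<close> with kernel \<open>Ann\<^sup>l\<close>, and a projection splits its domain into
  image and kernel.

  The reason is that the two identities defining \<open>AC_l\<close> mention \<open>a\<close> only through the
  operator \<open>L\<^sub>a = (\<lambda>x. a \<cdot> x)\<close>, while the second of them, taken at \<open>x = y = 1\<^sub>l\<close>, says that
  \<open>a \<cdot> 1\<^sub>l\<close> and \<open>a\<close> have the same operator (\<open>mult_AC_l_one\<close>). Hence \<open>a \<cdot> 1\<^sub>l\<close> lies in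
  \<open>AC_l\<close> again, and the difference \<open>a - a \<cdot> 1\<^sub>l\<close> has operator \<open>0\<close>, which means that it lies in
  the annihilator. Conversely an element \<open>a \<cdot> 1\<^sub>l\<close> of the annihilator is \<open>0\<close>, because
  \<open>a\<close> then has operator \<open>0\<close> as well and so kills \<open>1\<^sub>l\<close>.
  The final equivalence says that the first summand is everything exactly when the second one
  vanishes.
\<close>

lemma AC_l_cong:
  assumes "\<And>x. m a x = m b x"
  shows "a \<in> AC_l m \<longleftrightarrow> b \<in> AC_l m"
  using assms by (simp add: AC_l_def)

lemma AC_l_assoc: "a \<in> AC_l m \<Longrightarrow> m (m a x) (m y z) = m a (m (m x y) z)"
  by (simp add: AC_l_def)

context algebra_over_field
begin

lemma mult_add_left: "(x + y) \<cdot> z = x \<cdot> z + y \<cdot> z"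
  using linear_mult_left by (rule Vector_Spaces.linear.axioms(3)[THEN module_hom.add])

lemma mult_add_right: "x \<cdot> (y + z) = x \<cdot> y + x \<cdot> z"
  using linear_mult_right by (rule Vector_Spaces.linear.axioms(3)[THEN module_hom.add])

lemma mult_scale_left: "(c *s x) \<cdot> y = c *s (x \<cdot> y)"
  using linear_mult_left by (rule Vector_Spaces.linear.axioms(3)[THEN module_hom.scale])

lemma mult_scale_right: "x \<cdot> (c *s y) = c *s (x \<cdot> y)"
  using linear_mult_right by (rule Vector_Spaces.linear.axioms(3)[THEN module_hom.scale])

lemma mult_zero_left: "0 \<cdot> x = 0"
  using mult_add_left[of 0 0 x] by simp

lemma mult_zero_right: "x \<cdot> 0 = 0"
  using mult_add_right[of x 0 0] by simp

lemma mult_diff_left: "(x - y) \<cdot> z = x \<cdot> z - y \<cdot> z"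
  using mult_add_left[of "x - y" y z] by simp

lemma subspace_AC_l: "subspace (AC_l mult)"
  by (simp add: subspace_def AC_l_def mult_zero_left mult_zero_right
      mult_add_left mult_add_right mult_scale_left mult_scale_right)

lemma subspace_AC_l_one: "subspace (AC_l_one mult e)"
proof -
  have "AC_l_one mult e = (\<lambda>a. a \<cdot> e) ` AC_l mult"
    by (auto simp: AC_l_one_def)
  then show ?thesis
    using module_hom.subspace_image[OF Vector_Spaces.linear.axioms(3)[OF linear_mult_left]
        subspace_AC_l] by simp
qed

lemma subspace_Ann_l: "subspace (Ann_l mult)"
  by (simp add: subspace_def Ann_l_def mult_zero_left mult_add_left mult_scale_left)

lemma Ann_l_subset_AC_l: "Ann_l mult \<subseteq> AC_l mult"
  by (auto simp: Ann_l_def AC_l_def mult_zero_left mult_zero_right)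

end

context left_unital_algebra
begin

text \<open>
  Both factors \<open>x\<close> and \<open>y\<close> of the second defining identity are specialised to \<open>1\<^sub>l\<close>; the
  left unit then disappears from every place except the one to the right of \<open>a\<close>.
\<close>

lemma mult_AC_l_one:
  assumes "a \<in> AC_l mult"
  shows "a \<cdot> 1\<^sub>l \<cdot> z = a \<cdot> z"
  using AC_l_assoc[OF assms, of "1\<^sub>l" "1\<^sub>l" z] by (simp add: left_unit)

lemma AC_l_one_subset_AC_l: "AC_l_one mult 1\<^sub>l \<subseteq> AC_l mult"
proof
  fix b assume "b \<in> AC_l_one mult 1\<^sub>l"
  then obtain a where a: "a \<in> AC_l mult" and b: "b = a \<cdot> 1\<^sub>l"
    by (auto simp: AC_l_one_def)
  show "b \<in> AC_l mult"
    using a AC_l_cong[of mult b a] by (simp add: b mult_AC_l_one)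
qed

lemma diff_mult_one_in_Ann_l:
  assumes "a \<in> AC_l mult"
  shows "a - a \<cdot> 1\<^sub>l \<in> Ann_l mult"
  by (simp add: Ann_l_def mult_diff_left mult_AC_l_one[OF assms])

lemma AC_l_one_Int_Ann_l: "AC_l_one mult 1\<^sub>l \<inter> Ann_l mult = {0}"
proof
  show "AC_l_one mult 1\<^sub>l \<inter> Ann_l mult \<subseteq> {0}"
  proof
    fix b assume "b \<in> AC_l_one mult 1\<^sub>l \<inter> Ann_l mult"
    then obtain a where a: "a \<in> AC_l mult" and b: "b = a \<cdot> 1\<^sub>l" and ann: "b \<cdot> 1\<^sub>l = 0"
      by (auto simp: AC_l_one_def Ann_l_def)
    show "b \<in> {0}"
      using mult_AC_l_one[OF a, of "1\<^sub>l"] ann by (simp add: b)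
  qed
  show "{0} \<subseteq> AC_l_one mult 1\<^sub>l \<inter> Ann_l mult"
    using subspace_0[OF subspace_AC_l_one] subspace_0[OF subspace_Ann_l] by simp
qed

lemma AC_l_eq_sum: "AC_l mult = {v + w | v w. v \<in> AC_l_one mult 1\<^sub>l \<and> w \<in> Ann_l mult}"
proof (intro subset_antisym subsetI)
  fix a assume a: "a \<in> AC_l mult"
  then have "a \<cdot> 1\<^sub>l \<in> AC_l_one mult 1\<^sub>l"
    by (auto simp: AC_l_one_def)
  moreover have "a = a \<cdot> 1\<^sub>l + (a - a \<cdot> 1\<^sub>l)"
    by simp
  ultimately show "a \<in> {v + w | v w. v \<in> AC_l_one mult 1\<^sub>l \<and> w \<in> Ann_l mult}"
    using diff_mult_one_in_Ann_l[OF a] by blast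
next
  fix a assume "a \<in> {v + w | v w. v \<in> AC_l_one mult 1\<^sub>l \<and> w \<in> Ann_l mult}"
  then show "a \<in> AC_l mult"
    using AC_l_one_subset_AC_l Ann_l_subset_AC_l subspace_add[OF subspace_AC_l] by auto
qed

lemma AC_l_one_eq_AC_l_iff: "AC_l_one mult 1\<^sub>l = AC_l mult \<longleftrightarrow> Ann_l mult = {0}"
proof
  assume "AC_l_one mult 1\<^sub>l = AC_l mult"
  then show "Ann_l mult = {0}"
    using AC_l_one_Int_Ann_l Ann_l_subset_AC_l by auto
next
  assume "Ann_l mult = {0}"
  then show "AC_l_one mult 1\<^sub>l = AC_l mult"
    by (simp add: AC_l_eq_sum)
qed

end

theorem theorem34:
  fixes scale :: "'f::field \<Rightarrow> 'a::ab_group_add \<Rightarrow> 'a"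
    and mult :: "'a \<Rightarrow> 'a \<Rightarrow> 'a"
    and one_l :: 'a
  assumes "left_unital_algebra scale mult one_l"
  shows "internal_direct_sum scale (AC_l mult) (AC_l_one mult one_l) (Ann_l mult) \<and>
         (AC_l_one mult one_l = AC_l mult \<longleftrightarrow> Ann_l mult = {0})"
proof -
  interpret left_unital_algebra scale mult one_l
    by (fact assms)
  show ?thesis
    unfolding internal_direct_sum_def
    using subspace_AC_l subspace_AC_l_one subspace_Ann_l AC_l_eq_sum AC_l_one_Int_Ann_l
      AC_l_one_eq_AC_l_iff by blast
qed

end
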